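(* There is an absolute constant $\epsilon_0>0$ such that every (possibly adaptive, $2$-sided error) unateness tester for functions $f:\{0,1\}^d\to\mathbb{R}$ with proximity parameter $\epsilon_0$ must make $\Omega(d)$ queries.
   Context: A function $f:\{0,1\}^d\to\mathbb{R}$ is unate if each dimension $i\in[d]$ can be assigned a direction up or down such that: if up, $f(x)\le f(x+e_i)$ for all $x$ with $x_i=0$ (here $x+e_i$ is $x$ with the $i$-th bit set to 1); if down, $f(x)\ge f(x+e_i)$ for all such $x$. The distance between two functions is the fraction of points where they differ; $f$ is $\epsilon$-far from unate if its distance to every unate function is at least $\epsilon$. A unateness tester is a randomized algorithm that, given $\epsilon$ and oracle (query) access to $f$, accepts with probability at least $2/3$ if $f$ is unate and rejects with probability at least $2/3$ if $f$ is $\epsilon$-far from unate; it may choose queries adaptively and may err on both sides. *)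

theory Defs
  imports "HOL-Probability.Probability"
begin

text \<open>Points of the hypercube {0,1}^d are boolean lists of length d
  (True = 1). Functions are total on bool list; only values on the cube matter.\<close>

definition cube :: "nat \<Rightarrow> bool list set" where
  "cube d = {x. length x = d}"

definition unate :: "nat \<Rightarrow> (bool list \<Rightarrow> real) \<Rightarrow> bool" where
  "unate d f \<longleftrightarrow> (\<exists>dir :: nat \<Rightarrow> bool. \<forall>i<d. \<forall>x\<in>cube d. \<not> x ! i \<longrightarrow>
      (if dir i then f x \<le> f (x[i := True]) else f x \<ge> f (x[i := True])))"

definition fdist :: "nat \<Rightarrow> (bool list \<Rightarrow> real) \<Rightarrow> (bool list \<Rightarrow> real) \<Rightarrow> real" where
  "fdist d f g = real (card {x\<in>cube d. f x \<noteq> g x}) / 2 ^ d"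

definition far_from_unate :: "nat \<Rightarrow> real \<Rightarrow> (bool list \<Rightarrow> real) \<Rightarrow> bool" where
  "far_from_unate d \<epsilon> f \<longleftrightarrow> (\<forall>g. unate d g \<longrightarrow> fdist d f g \<ge> \<epsilon>)"

text \<open>A deterministic adaptive q-query algorithm: the next query is a function of
  the answers received so far; the decision is a function of all q answers.\<close>
fun run :: "(real list \<Rightarrow> bool list) \<Rightarrow> (bool list \<Rightarrow> real) \<Rightarrow> nat \<Rightarrow> real list" where
  "run qry f 0 = []"
| "run qry f (Suc k) = (let as = run qry f k in as @ [f (qry as)])"

text \<open>A randomized (adaptive, two-sided error) tester making q queries: a probability
  space M of random coin sequences; for each outcome w, a deterministic adaptive
  algorithm (query rule Q w, decision rule D w; True = accept).\<close>
definition unateness_tester ::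
  "nat \<Rightarrow> real \<Rightarrow> nat \<Rightarrow> (nat \<Rightarrow> bool) measure \<Rightarrow>
   ((nat \<Rightarrow> bool) \<Rightarrow> real list \<Rightarrow> bool list) \<Rightarrow> ((nat \<Rightarrow> bool) \<Rightarrow> real list \<Rightarrow> bool) \<Rightarrow> bool" where
  "unateness_tester d \<epsilon> q M Q D \<longleftrightarrow> prob_space M \<and>
     (\<forall>f. unate d f \<longrightarrow> measure M {w\<in>space M. D w (run (Q w) f q)} \<ge> 2/3) \<and>
     (\<forall>f. far_from_unate d \<epsilon> f \<longrightarrow> measure M {w\<in>space M. \<not> D w (run (Q w) f q)} \<ge> 2/3)"

end

theory Submission
  imports Defs
begin

text \<open>Every bit \<open>k\<close> of \<open>x\<close> contributes a weight \<open>b ^ (d - k)\<close>, and every proper prefix of \<open>x\<close>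
  contributes a random offset, which is of much larger order than the weight of the bit following
  it and much smaller than the weight of the bit before. Hence all these functions are monotone.
  Reversing the sign of one bit \<open>i \<noteq> 0\<close> on the half cube \<open>x ! 0\<close> makes the function 1/4-far from
  unate. The reversal can be absorbed by the offset of the prefix of length \<open>i\<close>, except when the
  tester has queried two points whose first difference is at position \<open>i\<close>. As \<open>q\<close> points have
  fewer than \<open>q\<close> positions of first difference, a tester with few queries misses most \<open>i\<close>.\<close>

section \<open>Positions of first difference within a set of points\<close>

definition diverge :: "nat \<Rightarrow> 'a list \<Rightarrow> 'a list \<Rightarrow> bool" where
  "diverge i x y \<longleftrightarrow> i < length x \<and> i < length y \<and> take i x = take i y \<and> x ! i \<noteq> y ! i"

definition levels :: "'a list set \<Rightarrow> nat set" where
  "levels X = {i. \<exists>x\<in>X. \<exists>y\<in>X. diverge i x y}"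

lemma diverge_sym: "diverge i x y \<longleftrightarrow> diverge i y x"
  by (auto simp: diverge_def)

lemma diverge_common_prefix:
  assumes "diverge k x z" "diverge i x y" "i < k"
  shows "diverge i z y"
proof -
  have tk: "take k x = take k z" using assms(1) by (simp add: diverge_def)
  have "take i x = take i z"
    using arg_cong[OF tk, of "take i"] assms(3) by (simp add: min_def)
  moreover have "x ! i = z ! i"
    using arg_cong[OF tk, of "\<lambda>l. l ! i"] assms(3) by simp
  ultimately show ?thesis
    using assms by (auto simp: diverge_def)
qed

text \<open>Inserting \<open>x\<close> adds at most one level. Let \<open>Max N\<close> be the
  deepest divergence of \<open>x\<close> from the old points, attained at \<open>z\<close>. Where
  \<open>x\<close> diverges earlier from some old \<open>y\<close>, it still agrees with
  \<open>z\<close>, so \<open>z\<close> diverges from \<open>y\<close> there and the level was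
  present before.\<close>

lemma card_levels_le:
  assumes "finite X"
  shows "finite (levels X) \<and> card (levels X) \<le> card X"
  using assms
proof (induction X)
  case empty
  then show ?case by (simp add: levels_def)
next
  case (insert x X)
  define N where "N = {i. \<exists>y\<in>X. diverge i x y}"
  have finN: "finite N"
    by (rule finite_subset[of _ "{..<length x}"]) (auto simp: N_def diverge_def)
  have eq: "levels (insert x X) = levels X \<union> N"
  proof -
    have "\<not> diverge i x x" for i by (simp add: diverge_def)
    moreover have "i \<in> N" if "y \<in> X" "diverge i y x" for i y
      using that diverge_sym[of i y x] by (auto simp: N_def)
    moreover have "N \<subseteq> levels (insert x X)" "levels X \<subseteq> levels (insert x X)"
      unfolding N_def levels_def by blast+
    moreover have "levels (insert x X) \<subseteq> levels X \<union> N"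
    proof
      fix i assume "i \<in> levels (insert x X)"
      then obtain y z where "y \<in> insert x X" "z \<in> insert x X" "diverge i y z"
        by (auto simp: levels_def)
      with calculation(1,2) show "i \<in> levels X \<union> N"
        unfolding levels_def N_def by blast
    qed
    ultimately show ?thesis by blast
  qed
  \<comment> \<open>For empty \<open>N\<close> the value \<open>Max N\<close> is unspecified, but
    the inclusion is then trivial.\<close>
  have "N \<subseteq> insert (Max N) (levels X)"
  proof
    fix i assume i: "i \<in> N"
    show "i \<in> insert (Max N) (levels X)"
    proof (cases "i = Max N")
      case False
      with finN i have lt: "i < Max N" by (simp add: order_le_neq_trans)
      have "Max N \<in> N" using finN i by (auto intro: Max_in)
      then obtain z where z: "z \<in> X" "diverge (Max N) x z" by (auto simp: N_def)
      from i obtain y where y: "y \<in> X" "diverge i x y" by (auto simp: N_def)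
      have "diverge i z y" by (rule diverge_common_prefix[OF z(2) y(2) lt])
      with z y show ?thesis by (auto simp: levels_def)
    qed simp
  qed
  hence sub: "levels (insert x X) \<subseteq> insert (Max N) (levels X)" using eq by auto
  have "card (levels (insert x X)) \<le> card (insert (Max N) (levels X))"
    using sub insert.IH by (intro card_mono) auto
  also have "\<dots> \<le> Suc (card (levels X))" by (simp add: card_insert_le_m1 card_insert_if insert.IH)
  finally show ?case using insert sub finite_subset by fastforce
qed

section \<open>Runs of adaptive algorithms\<close>

definition queries :: "(real list \<Rightarrow> bool list) \<Rightarrow> (bool list \<Rightarrow> real) \<Rightarrow> nat \<Rightarrow> bool list set" where
  "queries qry f n = (\<lambda>k. qry (run qry f k)) ` {..<n}"

lemma card_queries_le: "finite (queries qry f n)" "card (queries qry f n) \<le> n"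
  unfolding queries_def using card_image_le[of "{..<n}"] by auto

text \<open>Adaptivity is dealt with here: agreement is assumed only at the points queried on
  \<open>f\<close>. By induction the answers so far coincide, hence so does the next query.\<close>

lemma run_cong:
  assumes "\<And>x. x \<in> queries qry f n \<Longrightarrow> f x = g x"
  shows "run qry f n = run qry g n"
  using assms
proof (induction n)
  case (Suc n)
  have "queries qry f n \<subseteq> queries qry f (Suc n)" by (auto simp: queries_def)
  then have "run qry f n = run qry g n" using Suc by blast
  moreover have "f (qry (run qry f n)) = g (qry (run qry f n))"
    using Suc.prems by (auto simp: queries_def)
  ultimately show ?case by (simp add: Let_def)
qed simp

lemma queries_cong:
  assumes "\<And>x. x \<in> queries qry f n \<Longrightarrow> f x = g x"
  shows "queries qry f n = queries qry g n"
proof -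
  have "run qry f k = run qry g k" if "k < n" for k
    using that assms by (intro run_cong) (auto simp: queries_def)
  then show ?thesis by (auto simp: queries_def)
qed

section \<open>The hard functions: unateness and distance from unateness\<close>

text \<open>The sign of bit \<open>i\<close> is reversed on the half cube \<open>x ! 0\<close>; for \<open>i = d\<close> nothing is reversed.\<close>

definition tree_fun :: "nat \<Rightarrow> nat \<Rightarrow> nat \<Rightarrow> (bool list \<Rightarrow> nat) \<Rightarrow> bool list \<Rightarrow> real" where
  "tree_fun d b i U x = (if length x = d then
     \<Sum>k<d. (if k = i \<and> x ! 0 then -1 else 1) * (if x ! k then real (b ^ (d - k)) else 0)
            + real (U (take k x))
   else 0)"

text \<open>The summands telescope as \<open>b ^ (d - j + 1) - b ^ (d - j)\<close>, with total
  \<open>b ^ (d - k) - b\<close>. Thus all offsets of prefixes containing bit \<open>k\<close>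
  together cannot outweigh that bit.\<close>

lemma sum_offsets_less:
  fixes b :: real
  assumes "b \<ge> 1" "k < d"
  shows "(\<Sum>j\<in>{k<..<d}. (b - 1) * b ^ (d - j)) < b ^ (d - k)"
  using assms(2)
proof (induction "d - k" arbitrary: k)
  case (Suc n)
  show ?case
  proof (cases "Suc k < d")
    case True
    have set: "{k<..<d} = insert (Suc k) {Suc k<..<d}" using True by auto
    have "(\<Sum>j\<in>{k<..<d}. (b - 1) * b ^ (d - j))
        = (b - 1) * b ^ (d - Suc k) + (\<Sum>j\<in>{Suc k<..<d}. (b - 1) * b ^ (d - j))"
      unfolding set by simp
    also have "\<dots> < (b - 1) * b ^ (d - Suc k) + b ^ (d - Suc k)"
      using Suc.hyps(1)[of "Suc k"] Suc.hyps(2) True by simp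
    also have "\<dots> = b * b ^ (d - Suc k)" by (simp add: algebra_simps)
    also have "\<dots> = b ^ (d - k)"
      using Suc.prems by (metis Suc_diff_Suc power_Suc)
    finally show ?thesis .
  next
    case False
    then have "{k<..<d} = {}" by auto
    then show ?thesis using assms(1) by simp
  qed
qed simp

text \<open>Setting bit \<open>k\<close> leaves the summands before \<open>k\<close> alone and
  changes summand \<open>k\<close> by exactly its signed weight, as the prefix of length
  \<open>k\<close> does not contain bit \<open>k\<close>. Later summands change only through their
  offsets, by less than this weight in total.\<close>

lemma tree_fun_edge:
  fixes s :: real
  assumes b: "b \<ge> 1" and k: "k < d" "k \<noteq> 0 \<or> i = d" and x: "length x = d" "\<not> x ! k"
    and U: "\<And>p. length p < d \<Longrightarrow> U p \<le> (b - 1) * b ^ (d - length p)"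
    and s: "s = (if k = i \<and> x ! 0 then -1 else 1)"
  shows "s * (tree_fun d b i U (x[k := True]) - tree_fun d b i U x) > 0"
proof -
  define y where "y = x[k := True]"
  define t where "t = (\<lambda>z j. (if j = i \<and> z ! 0 then -1 else 1) * (if z ! j then real (b ^ (d - j)) else 0)
            + real (U (take j z)))"
  define \<delta> where "\<delta> = (\<lambda>j. t y j - t x j)"
  \<comment> \<open>Setting bit 0 moves the point to the other half cube, which is harmless only
    when no bit is reversed; hence the hypothesis \<open>k \<noteq> 0 \<or> i = d\<close>.\<close>
  have y0: "j = i \<and> y ! 0 \<longleftrightarrow> j = i \<and> x ! 0" if "j < d" for j
    using k x that by (auto simp: y_def nth_list_update)
  have diff: "tree_fun d b i U y - tree_fun d b i U x = (\<Sum>j<d. \<delta> j)"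
    using x by (simp add: tree_fun_def t_def \<delta>_def y_def sum_subtractf)
  have lo: "\<delta> j = 0" if "j < k" for j
    using that y0[of j] k by (simp add: \<delta>_def t_def y_def)
  have mid: "\<delta> k = s * real b ^ (d - k)"
    using y0[of k] k x by (simp add: \<delta>_def t_def y_def s)
  have hi: "\<bar>\<delta> j\<bar> \<le> (real b - 1) * real b ^ (d - j)" if j: "j \<in> {k<..<d}" for j
  proof -
    have "\<delta> j = real (U (take j y)) - real (U (take j x))"
      using y0[of j] j by (simp add: \<delta>_def t_def y_def)
    moreover have "real (U (take j y)) \<le> real ((b - 1) * b ^ (d - j))"
      using U[of "take j y"] j x by (simp add: y_def min_def del: of_nat_mult)
    moreover have "real (U (take j x)) \<le> real ((b - 1) * b ^ (d - j))"
      using U[of "take j x"] j x by (simp add: min_def del: of_nat_mult)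
    moreover have "real ((b - 1) * b ^ (d - j)) = (real b - 1) * real b ^ (d - j)"
      using b by simp
    ultimately show ?thesis by linarith
  qed
  have "{..<d} = {..<k} \<union> insert k {k<..<d}" using k by auto
  then have "(\<Sum>j<d. \<delta> j) = (\<Sum>j\<in>insert k {k<..<d}. \<delta> j)"
    using lo by (intro sum.mono_neutral_right) auto
  also have "\<dots> = s * real b ^ (d - k) + (\<Sum>j\<in>{k<..<d}. \<delta> j)" by (simp add: mid)
  finally have tot: "(\<Sum>j<d. \<delta> j) = s * real b ^ (d - k) + (\<Sum>j\<in>{k<..<d}. \<delta> j)" .
  have "\<bar>\<Sum>j\<in>{k<..<d}. \<delta> j\<bar> \<le> (\<Sum>j\<in>{k<..<d}. (real b - 1) * real b ^ (d - j))"
    by (rule order_trans[OF sum_abs sum_mono]) (rule hi)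
  also have "\<dots> < real b ^ (d - k)"
    using b k by (intro sum_offsets_less) auto
  finally have "\<bar>\<Sum>j\<in>{k<..<d}. \<delta> j\<bar> < real b ^ (d - k)" .
  then show ?thesis
    using tot diff by (auto simp: y_def s algebra_simps)
qed

lemma unate_tree_fun:
  assumes "b \<ge> 1" "\<And>p. length p < d \<Longrightarrow> U p \<le> (b - 1) * b ^ (d - length p)"
  shows "unate d (tree_fun d b d U)"
  unfolding unate_def
proof (intro exI[of _ "\<lambda>_. True"] allI impI ballI)
  fix i x assume "i < d" "x \<in> cube d" "\<not> x ! i"
  then show "if True then tree_fun d b d U x \<le> tree_fun d b d U (x[i := True])
      else tree_fun d b d U (x[i := True]) \<le> tree_fun d b d U x"
    using tree_fun_edge[of b i d d x U 1] assms by (auto simp: cube_def)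
qed

lemma finite_cube: "finite (cube d)" and card_cube: "card (cube d) = 2 ^ d"
  using finite_lists_length_eq[of "UNIV :: bool set" d] card_lists_length_eq[of "UNIV :: bool set" d]
  by (simp_all add: cube_def)

text \<open>Overwriting bits 0 and \<open>i\<close> in the four possible ways maps this set onto the
  whole cube.\<close>

lemma card_quarter_cube:
  assumes "i \<noteq> 0" "i < d"
  shows "2 ^ d \<le> 4 * card {x\<in>cube d. x ! 0 = a \<and> \<not> x ! i}"
proof -
  define S where "S = {x\<in>cube d. x ! 0 = a \<and> \<not> x ! i}"
  have fS: "finite S" using finite_cube by (simp add: S_def)
  have "cube d \<subseteq> (\<lambda>(u, v, x). x[0 := u, i := v]) ` (UNIV \<times> UNIV \<times> S)"
  proof
    fix x assume x: "x \<in> cube d"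
    have "x = (\<lambda>(u, v, x). x[0 := u, i := v]) (x ! 0, x ! i, x[0 := a, i := False])"
    proof -
      have "x = x[0 := a, i := False, 0 := x ! 0, i := x ! i]"
      proof (rule nth_equalityI)
        fix j assume "j < length x"
        moreover have "0 < length x" using assms x by (simp add: cube_def)
        ultimately show "x ! j = x[0 := a, i := False, 0 := x ! 0, i := x ! i] ! j"
          by (cases "j = i"; cases "j = 0") (use assms(1) in simp_all)
      qed simp
      then show ?thesis by simp
    qed
    moreover have "x[0 := a, i := False] \<in> S"
      using assms x by (auto simp: S_def cube_def nth_list_update)
    ultimately show "x \<in> (\<lambda>(u, v, x). x[0 := u, i := v]) ` (UNIV \<times> UNIV \<times> S)" by blast
  qed
  then have "card (cube d) \<le> card (UNIV \<times> UNIV \<times> S :: (bool \<times> bool \<times> bool list) set)"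
    using fS by (intro surj_card_le) auto
  then show ?thesis by (simp add: card_cube card_cartesian_product S_def)
qed

text \<open>At least a quarter of \<open>2 ^ d\<close> pairwise disjoint edges in dimension
  \<open>i\<close> are strictly monotone against the direction of \<open>g\<close>, and on each of
  them \<open>f\<close> and \<open>g\<close> must differ at an endpoint.\<close>

lemma far_tree_fun:
  assumes b: "b \<ge> 1" and U: "\<And>p. length p < d \<Longrightarrow> U p \<le> (b - 1) * b ^ (d - length p)"
    and i: "i \<noteq> 0" "i < d"
  shows "far_from_unate d (1/4) (tree_fun d b i U)"
  unfolding far_from_unate_def
proof (intro allI impI)
  fix g assume "unate d g"
  then obtain dir where dir: "\<And>j x. \<lbrakk>j < d; x \<in> cube d; \<not> x ! j\<rbrakk> \<Longrightarrow>
      if dir j then g x \<le> g (x[j := True]) else g x \<ge> g (x[j := True])"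
    by (auto simp: unate_def)
  define f where "f = tree_fun d b i U"
  \<comment> \<open>The half cube is chosen by \<open>g\<close>: if \<open>g\<close> goes up in
    dimension \<open>i\<close>, take the reversed half, where \<open>f\<close> goes down; otherwise
    the other half, where \<open>f\<close> goes up.\<close>
  define S where "S = {x\<in>cube d. x ! 0 = dir i \<and> \<not> x ! i}"
  define E where "E = {x\<in>cube d. f x \<noteq> g x}"
  have edge: "x \<in> E \<or> x[i := True] \<in> E" if x: "x \<in> S" for x
  proof -
    have "(if dir i then -1 else 1) * (f (x[i := True]) - f x) > 0"
      using tree_fun_edge[OF b i(2) _ _ _ U refl, of i x] i x
      by (auto simp: S_def f_def cube_def split: if_splits)
    moreover have "if dir i then g x \<le> g (x[i := True]) else g x \<ge> g (x[i := True])"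
      using dir[of i x] i x by (auto simp: S_def)
    ultimately have "f x \<noteq> g x \<or> f (x[i := True]) \<noteq> g (x[i := True])"
      by (auto split: if_splits)
    then show ?thesis using x by (auto simp: S_def E_def cube_def)
  qed
  \<comment> \<open>\<open>h\<close> selects an endpoint where \<open>f\<close> and \<open>g\<close>
    differ; clearing bit \<open>i\<close> recovers the edge, so \<open>h\<close> is
    injective.\<close>
  define h where "h = (\<lambda>x. if x \<in> E then x else x[i := True])"
  have "inj_on h S"
  proof (rule inj_onI)
    fix x y assume xy: "x \<in> S" "y \<in> S" "h x = h y"
    have "(h z)[i := False] = z" if "z \<in> S" for z
      using that i by (auto simp: h_def S_def cube_def list_update_same_conv)
    with xy show "x = y" by metis
  qed
  moreover have "h ` S \<subseteq> E" using edge by (auto simp: h_def)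
  moreover have "finite E" using finite_cube by (simp add: E_def)
  ultimately have "card S \<le> card E" by (rule card_inj_on_le)
  then have "2 ^ d \<le> 4 * card E"
    using card_quarter_cube[OF i, of "dir i"] by (simp add: S_def)
  then have "(2::real) ^ d \<le> 4 * real (card E)"
    by (metis of_nat_le_iff of_nat_mult of_nat_numeral of_nat_power)
  then show "1 / 4 \<le> fdist d (tree_fun d b i U) g"
    by (simp add: fdist_def E_def f_def field_simps)
qed

section \<open>Hiding the reversal in the offsets\<close>

text \<open>An offset is shared by all points through its prefix and cannot depend on their bit
  \<open>i\<close>. The set \<open>X\<close> of queried points decides which value of this bit is to
  be compensated.\<close>

definition absorb :: "nat \<Rightarrow> nat \<Rightarrow> bool list set \<Rightarrow> (bool list \<Rightarrow> nat) \<Rightarrow> bool list \<Rightarrow> nat" where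
  "absorb s i X U p =
     (if length p = i \<and> p ! 0 \<and> (\<exists>x\<in>X. take i x = p \<and> x ! i) then U p + s else U p)"

text \<open>Reversal turns the weight \<open>b ^ (d - i)\<close> of a set bit into its negative, so
  a shift by twice the weight restores the value.\<close>

lemma tree_fun_absorb:
  assumes i: "i \<noteq> 0" "i < d" and X: "i \<notin> levels X" and x: "x \<in> X \<inter> cube d"
  shows "tree_fun d b i (absorb (2 * b ^ (d - i)) i (X \<inter> cube d) U) x = tree_fun d b d U x"
proof -
  have len: "length x = d" using x by (simp add: cube_def)
  have eq: "(if k = i \<and> x ! 0 then -1 else 1) * (if x ! k then real (b ^ (d - k)) else 0)
            + real (absorb (2 * b ^ (d - i)) i (X \<inter> cube d) U (take k x)) =
        (if k = d \<and> x ! 0 then -1 else 1) * (if x ! k then real (b ^ (d - k)) else 0)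
            + real (U (take k x))" if k: "k < d" for k
  proof (cases "k = i \<and> x ! 0")
    case False
    then have "absorb (2 * b ^ (d - i)) i (X \<inter> cube d) U (take k x) = U (take k x)"
      using k len i by (auto simp: absorb_def)
    moreover have "(if k = i \<and> x ! 0 then -1 else 1 :: real) = 1"
      "(if k = d \<and> x ! 0 then -1 else 1 :: real) = 1"
      using False k by auto
    ultimately show ?thesis by (simp only:)
  next
    case True
    \<comment> \<open>As no two points of \<open>X\<close> first differ at \<open>i\<close>, all
      those through this prefix share bit \<open>i\<close> with \<open>x\<close>.\<close>
    have "(\<exists>y\<in>X \<inter> cube d. take i y = take i x \<and> y ! i) \<longleftrightarrow> x ! i"
    proof
      assume "\<exists>y\<in>X \<inter> cube d. take i y = take i x \<and> y ! i"
      then obtain y where y: "y \<in> X" "length y = d" "take i y = take i x" "y ! i"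
        by (auto simp: cube_def)
      then have "\<not> diverge i y x" using X x by (auto simp: levels_def)
      then show "x ! i" using y len i by (auto simp: diverge_def)
    qed (use x in auto)
    then show ?thesis using True k len i by (simp add: absorb_def)
  qed
  show ?thesis using len eq by (simp add: tree_fun_def)
qed

text \<open>Independent uniform offsets, encoded as a finite set in which probabilities become
  cardinalities. \<open>PiE\<close> fixes the values at longer lists, which \<open>tree_fun\<close>
  never reads on account of \<open>k < d\<close>.\<close>

definition offsets :: "nat \<Rightarrow> (nat \<Rightarrow> nat) \<Rightarrow> (bool list \<Rightarrow> nat) set" where
  "offsets d R = PiE {p. length p < d} (\<lambda>p. {..<R (length p)})"

lemma finite_prefixes: "finite {p :: bool list. length p < d}"
  using finite_lists_length_le[of "UNIV :: bool set" d] by (auto elim: rev_finite_subset)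

lemma finite_offsets: "finite (offsets d R)"
  unfolding offsets_def by (intro finite_PiE finite_prefixes) auto

text \<open>For a deterministic algorithm, absorbing the reversed bit into the
  offsets is injective on the runs that do not detect level \<open>i\<close>, since the shift is determined by
  the common transcript.\<close>

lemma card_accept_le:
  fixes R :: "nat \<Rightarrow> nat"
  assumes i: "i \<noteq> 0" "i < d"
    and R': "\<And>k. k < d \<Longrightarrow> R k + 2 * b ^ (d - k) \<le> R' k"
  shows "card {U\<in>offsets d R. acc (run qry (tree_fun d b d U) q)}
    \<le> card {U\<in>offsets d R. i \<in> levels (queries qry (tree_fun d b d U) q)}
      + card {U\<in>offsets d R'. acc (run qry (tree_fun d b i U) q)}"
    (is "card ?A \<le> card ?B + card ?C")
proof -
  define X where "X = (\<lambda>U. queries qry (tree_fun d b d U) q)"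
  define \<phi> where "\<phi> = (\<lambda>U. absorb (2 * b ^ (d - i)) i (X U \<inter> cube d) U)"
  have agree: "tree_fun d b d U x = tree_fun d b i (\<phi> U) x"
    if "U \<in> ?A - ?B" "x \<in> X U" for U x
  proof (cases "x \<in> cube d")
    case True
    then show ?thesis using that i tree_fun_absorb[of i d "X U" x b U] by (auto simp: \<phi>_def X_def)
  next
    \<comment> \<open>Queries off the cube reveal nothing, since both functions are 0 there.\<close>
    case False
    then show ?thesis by (simp add: tree_fun_def cube_def)
  qed
  have "inj_on \<phi> (?A - ?B)"
  proof (rule inj_onI)
    fix U V assume UV: "U \<in> ?A - ?B" "V \<in> ?A - ?B" "\<phi> U = \<phi> V"
    \<comment> \<open>The query set of \<open>U\<close> can be recovered from
      \<open>\<phi> U\<close> by running on the reversed function. Equal images therefore received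
      the same shift, which cancels.\<close>
    have X: "X W = queries qry (tree_fun d b i (\<phi> W)) q" if "W \<in> ?A - ?B" for W
      unfolding X_def by (rule queries_cong, rule agree[OF that]) (simp add: X_def)
    have XX: "X U = X V" unfolding X[OF UV(1)] X[OF UV(2)] UV(3) by (rule refl)
    show "U = V"
    proof
      fix p
      have "\<phi> U p = \<phi> V p" using UV(3) by (rule fun_cong)
      then show "U p = V p"
        unfolding \<phi>_def absorb_def XX
        by (cases "length p = i \<and> p ! 0 \<and> (\<exists>x\<in>X V \<inter> cube d. take i x = p \<and> x ! i)")
          (simp_all only: if_True if_False add_right_cancel simp_thms)
    qed
  qed
  moreover have "\<phi> ` (?A - ?B) \<subseteq> ?C"
  proof
    fix V assume "V \<in> \<phi> ` (?A - ?B)"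
    then obtain U where U: "V = \<phi> U" "U \<in> ?A - ?B" by (rule imageE)
    have run: "run qry (tree_fun d b d U) q = run qry (tree_fun d b i (\<phi> U)) q"
      by (rule run_cong, rule agree[OF U(2)]) (simp add: X_def)
    have off: "U \<in> offsets d R" using U(2) by simp
    \<comment> \<open>The shift may leave the range \<open>R\<close>; the larger range
      \<open>R'\<close> has room for it.\<close>
    have "\<phi> U \<in> offsets d R'"
    proof -
      have "\<phi> U p < R' (length p)" if "length p < d" for p
      proof -
        have "U p < R (length p)" using that off by (auto simp: offsets_def PiE_iff)
        moreover have "\<phi> U p \<le> U p + 2 * b ^ (d - length p)"
          by (simp add: \<phi>_def absorb_def)
        ultimately show ?thesis using R'[OF that] by linarith
      qed
      moreover have "\<phi> U p = undefined" if "\<not> length p < d" for p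
      proof -
        have "length p \<noteq> i" using that i by simp
        then have "\<phi> U p = U p" by (simp add: \<phi>_def absorb_def)
        then show ?thesis using that off by (auto simp: offsets_def PiE_iff extensional_def)
      qed
      ultimately show ?thesis by (auto simp: offsets_def PiE_iff extensional_def)
    qed
    then show "V \<in> ?C" using U(2) unfolding U(1) run[symmetric] by (simp add: run)
  qed
  moreover have "finite ?C" by (simp add: finite_offsets)
  ultimately have "card (?A - ?B) \<le> card ?C" by (rule card_inj_on_le)
  moreover have "card ?A \<le> card (?A - ?B) + card ?B"
  proof -
    have "card ?A \<le> card ((?A - ?B) \<union> ?B)" by (intro card_mono) (auto simp: finite_offsets)
    also have "\<dots> \<le> card (?A - ?B) + card ?B" by (rule card_Un_le)
    finally show ?thesis .
  qed
  ultimately show ?thesis by linarith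
qed

section \<open>Averaging over the reversed bit and over the coins\<close>

lemma sum_card_swap:
  assumes "finite A" "finite B"
  shows "(\<Sum>i\<in>A. card {u\<in>B. P i u}) = (\<Sum>u\<in>B. card {i\<in>A. P i u})"
proof -
  have "(\<Sum>i\<in>A. card {u\<in>B. P i u}) = (\<Sum>i\<in>A. \<Sum>u\<in>B. if P i u then 1 else 0)"
    using assms by (intro sum.cong) (auto simp: sum.If_cases Int_def)
  also have "\<dots> = (\<Sum>u\<in>B. \<Sum>i\<in>A. if P i u then 1 else 0)" by (rule sum.swap)
  also have "\<dots> = (\<Sum>u\<in>B. card {i\<in>A. P i u})"
    using assms by (intro sum.cong) (auto simp: sum.If_cases Int_def)
  finally show ?thesis .
qed

text \<open>Sum the bound for a single \<open>i\<close> over all \<open>d - 1\<close> candidates and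
  exchange the order of counting: for each fixed \<open>U\<close>, the at most \<open>q\<close>
  queried points have at most \<open>q\<close> levels, so at most \<open>q\<close> candidates are
  detected.\<close>

lemma sum_accept_le:
  assumes R': "\<And>k. k < d \<Longrightarrow> R k + 2 * b ^ (d - k) \<le> R' k"
  shows "(d - 1) * card {U\<in>offsets d R. acc (run qry (tree_fun d b d U) q)}
    \<le> q * card (offsets d R)
      + (\<Sum>i\<in>{0<..<d}. card {U\<in>offsets d R'. acc (run qry (tree_fun d b i U) q)})"
proof -
  let ?L = "\<lambda>U. levels (queries qry (tree_fun d b d U) q)"
  have "(d - 1) * card {U\<in>offsets d R. acc (run qry (tree_fun d b d U) q)}
    = (\<Sum>i\<in>{0<..<d}. card {U\<in>offsets d R. acc (run qry (tree_fun d b d U) q)})"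
    by simp
  also have "\<dots> \<le> (\<Sum>i\<in>{0<..<d}. card {U\<in>offsets d R. i \<in> ?L U}
      + card {U\<in>offsets d R'. acc (run qry (tree_fun d b i U) q)})"
    using R' by (intro sum_mono card_accept_le) auto
  also have "\<dots> = (\<Sum>i\<in>{0<..<d}. card {U\<in>offsets d R. i \<in> ?L U})
      + (\<Sum>i\<in>{0<..<d}. card {U\<in>offsets d R'. acc (run qry (tree_fun d b i U) q)})"
    by (rule sum.distrib)
  finally have split: "(d - 1) * card {U\<in>offsets d R. acc (run qry (tree_fun d b d U) q)}
    \<le> (\<Sum>i\<in>{0<..<d}. card {U\<in>offsets d R. i \<in> ?L U})
      + (\<Sum>i\<in>{0<..<d}. card {U\<in>offsets d R'. acc (run qry (tree_fun d b i U) q)})" .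
  have "(\<Sum>i\<in>{0<..<d}. card {U\<in>offsets d R. i \<in> ?L U})
      = (\<Sum>U\<in>offsets d R. card {i\<in>{0<..<d}. i \<in> ?L U})"
    by (intro sum_card_swap finite_offsets) auto
  also have "\<dots> \<le> (\<Sum>U\<in>offsets d R. q)"
  proof (rule sum_mono)
    fix U
    have L: "finite (?L U)" "card (?L U) \<le> card (queries qry (tree_fun d b d U) q)"
      using card_levels_le[OF card_queries_le(1)] by blast+
    have "card {i\<in>{0<..<d}. i \<in> ?L U} \<le> card (?L U)"
      by (rule card_mono[OF L(1)]) (rule subsetI, erule CollectE, erule conjunct2)
    also note L(2)
    also note card_queries_le(2)
    finally show "card {i\<in>{0<..<d}. i \<in> ?L U} \<le> q" .
  qed
  finally have "(\<Sum>i\<in>{0<..<d}. card {U\<in>offsets d R. i \<in> ?L U}) \<le> q * card (offsets d R)"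
    by (simp add: mult.commute)
  then show ?thesis using split by linarith
qed

text \<open>Integrating over the coins lifts a counting inequality for every deterministic algorithm
  to acceptance probabilities, as in the easy direction of Yao's principle.\<close>

lemma (in prob_space) sum_prob_le:
  fixes a c :: real
  assumes "finite I" "finite J" "\<And>u. u \<in> I \<Longrightarrow> A u \<in> events" "\<And>v. v \<in> J \<Longrightarrow> B v \<in> events"
    and le: "\<And>w. w \<in> space M \<Longrightarrow> a * card {u\<in>I. w \<in> A u} \<le> c + card {v\<in>J. w \<in> B v}"
  shows "a * (\<Sum>u\<in>I. prob (A u)) \<le> c + (\<Sum>v\<in>J. prob (B v))"
proof -
  have "a * (\<Sum>u\<in>I. prob (A u)) = (\<integral>w. a * (\<Sum>u\<in>I. indicator (A u) w) \<partial>M)"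
    using assms by (simp add: Bochner_Integration.integral_sum emeasure_eq_measure)
  also have "\<dots> \<le> (\<integral>w. c + (\<Sum>v\<in>J. indicator (B v) w) \<partial>M)"
  proof (rule integral_mono)
    fix w assume "w \<in> space M"
    then show "a * (\<Sum>u\<in>I. indicator (A u) w) \<le> c + (\<Sum>v\<in>J. indicator (B v) w)"
      using le[of w] assms(1,2) by (simp add: indicator_def sum.If_cases Int_def)
  qed (use assms in \<open>auto simp: emeasure_eq_measure\<close>)
  also have "\<dots> = c + (\<Sum>v\<in>J. prob (B v))"
    using assms by (simp add: Bochner_Integration.integral_sum emeasure_eq_measure prob_space)
  finally show ?thesis .
qed

section \<open>Choice of parameters and the lower bound\<close>

text \<open>Each prefix contributes a factor \<open>1 + 2 / K\<close>. With \<open>K\<close> ten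
  times the number of prefixes, the product is at most \<open>exp (1/5)\<close>, and
  \<open>exp (-1/5) \<ge> 4/5\<close> bounds this by 5/4.\<close>

lemma card_offsets_ratio:
  assumes d: "d \<ge> 1" and K: "K = 10 * card {p :: bool list. length p < d}"
    and R: "\<And>k. R k = K * B k" and R': "\<And>k. R' k = (K + 2) * B k" and B: "\<And>k. B k > 0"
  shows "4 * real (card (offsets d R')) \<le> 5 * real (card (offsets d R))" "card (offsets d R) > 0"
proof -
  define P where "P = {p :: bool list. length p < d}"
  have fP: "finite P" unfolding P_def by (rule finite_prefixes)
  have "[] \<in> P" using d by (simp add: P_def)
  with fP have cP: "card P > 0" by (auto simp: card_gt_0_iff)
  then have K0: "K > 0" using K by (simp add: P_def)
  have c: "real (card (offsets d r)) = (\<Prod>p\<in>P. real (r (length p)))" for r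
    unfolding offsets_def P_def[symmetric] using fP by (simp add: card_PiE)
  show "card (offsets d R) > 0"
    using c[of R] K0 B by (metis R mult_pos_pos of_nat_0_less_iff prod_pos)
  have "real (card (offsets d R')) = (\<Prod>p\<in>P. (1 + 2 / real K) * real (R (length p)))"
    unfolding c using K0 by (intro prod.cong) (auto simp: R R' field_simps)
  also have "\<dots> = (1 + 2 / real K) ^ card P * real (card (offsets d R))"
    unfolding c by (simp add: prod.distrib)
  finally have eq: "real (card (offsets d R')) = (1 + 2 / real K) ^ card P * real (card (offsets d R))" .
  have "(1 + 2 / real K) ^ card P \<le> exp (2 / real K) ^ card P"
    by (intro power_mono exp_ge_add_one_self) auto
  also have "\<dots> = exp (1 / 5)"
    unfolding exp_of_nat_mult[symmetric] using cP by (simp add: K P_def)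
  also have "\<dots> \<le> 5 / 4"
    using exp_ge_add_one_self[of "- (1/5)"] by (simp add: exp_minus field_simps)
  finally have "real (card (offsets d R')) \<le> 5 / 4 * real (card (offsets d R))"
    unfolding eq by (intro mult_right_mono) auto
  then show "4 * real (card (offsets d R')) \<le> 5 * real (card (offsets d R))" by simp
qed

lemma unateness_tester_queries:
  assumes T: "unateness_tester d (1/4) q M Q D" and d: "d \<ge> 2"
  shows "real (d - 1) \<le> 4 * real q"
proof -
  define K where "K = 10 * card {p :: bool list. length p < d}"
  \<comment> \<open>With this base \<open>b - 1 = K + 2\<close>, so even the enlarged offsets below
    \<open>R'\<close> obey the bound under which the sign of every edge is controlled.\<close>
  define b where "b = K + 3"
  define R where "R = (\<lambda>k. K * b ^ (d - k))"
  define R' where "R' = (\<lambda>k. (K + 2) * b ^ (d - k))"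
  interpret prob_space M using T by (simp add: unateness_tester_def)
  have R_le: "R k + 2 * b ^ (d - k) \<le> R' k" for k by (simp add: R_def R'_def algebra_simps)
  have b: "b \<ge> 1" "b - 1 = K + 2" by (simp_all add: b_def)
  have bnd': "U p \<le> (b - 1) * b ^ (d - length p)" if "U \<in> offsets d R'" "length p < d" for U p
    using that b by (fastforce simp: offsets_def PiE_iff R'_def)
  have bnd: "U p \<le> (b - 1) * b ^ (d - length p)" if "U \<in> offsets d R" "length p < d" for U p
  proof -
    have "U p < R (length p)" using that by (auto simp: offsets_def PiE_iff)
    then show ?thesis using R_le[of "length p"] b by (simp add: R'_def)
  qed
  define acc where "acc = (\<lambda>f. {w\<in>space M. D w (run (Q w) f q)})"
  define rej where "rej = (\<lambda>f. {w\<in>space M. \<not> D w (run (Q w) f q)})"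
  have yes: "acc (tree_fun d b d U) \<in> events" "prob (acc (tree_fun d b d U)) \<ge> 2/3"
    if "U \<in> offsets d R" for U
  proof -
    have "unate d (tree_fun d b d U)" using b bnd[OF that] by (intro unate_tree_fun) auto
    then show "prob (acc (tree_fun d b d U)) \<ge> 2/3"
      using T by (simp add: unateness_tester_def acc_def)
    then show "acc (tree_fun d b d U) \<in> events"
      using measure_notin_sets by fastforce
  qed
  have no: "acc (tree_fun d b i U) \<in> events" "prob (acc (tree_fun d b i U)) \<le> 1/3"
    if "U \<in> offsets d R'" "i \<in> {0<..<d}" for i U
  proof -
    have "far_from_unate d (1/4) (tree_fun d b i U)"
      using b bnd'[OF that(1)] that(2) by (intro far_tree_fun) auto
    then have r: "prob (rej (tree_fun d b i U)) \<ge> 2/3"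
      using T by (simp add: unateness_tester_def rej_def)
    then have ev: "rej (tree_fun d b i U) \<in> events"
      using measure_notin_sets by fastforce
    have eq: "acc (tree_fun d b i U) = space M - rej (tree_fun d b i U)"
      by (auto simp: acc_def rej_def)
    show "acc (tree_fun d b i U) \<in> events" using ev by (simp add: eq)
    show "prob (acc (tree_fun d b i U)) \<le> 1/3" using r ev by (simp add: eq prob_compl)
  qed
  define J where "J = {0<..<d} \<times> offsets d R'"
  define N where "N = real (card (offsets d R))"
  define m where "m = real (d - 1)"
  have "m * (\<Sum>U\<in>offsets d R. prob (acc (tree_fun d b d U)))
      \<le> q * N + (\<Sum>(i, U)\<in>J. prob (acc (tree_fun d b i U)))"
    unfolding case_prod_beta
  proof (rule sum_prob_le)
    fix w assume w: "w \<in> space M"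
    have "{v\<in>J. w \<in> acc (tree_fun d b (fst v) (snd v))}
      = (SIGMA i:{0<..<d}. {U\<in>offsets d R'. D w (run (Q w) (tree_fun d b i U) q)})"
      using w by (auto simp: J_def acc_def)
    then have "card {v\<in>J. w \<in> acc (tree_fun d b (fst v) (snd v))}
      = (\<Sum>i\<in>{0<..<d}. card {U\<in>offsets d R'. D w (run (Q w) (tree_fun d b i U) q)})"
      by (simp add: finite_offsets)
    moreover have "{U\<in>offsets d R. w \<in> acc (tree_fun d b d U)}
      = {U\<in>offsets d R. D w (run (Q w) (tree_fun d b d U) q)}"
      using w by (auto simp: acc_def)
    ultimately have "(d - 1) * card {U\<in>offsets d R. w \<in> acc (tree_fun d b d U)}
      \<le> q * card (offsets d R) + card {v\<in>J. w \<in> acc (tree_fun d b (fst v) (snd v))}"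
      using sum_accept_le[where acc = "D w" and qry = "Q w", of d R b R' q] R_le by simp
    then show "m * card {U\<in>offsets d R. w \<in> acc (tree_fun d b d U)}
      \<le> q * N + card {v\<in>J. w \<in> acc (tree_fun d b (fst v) (snd v))}"
      unfolding m_def N_def of_nat_mult[symmetric] of_nat_add[symmetric] of_nat_le_iff .
  qed (use yes no in \<open>auto simp: J_def finite_offsets\<close>)
  moreover have "(\<Sum>U\<in>offsets d R. prob (acc (tree_fun d b d U))) \<ge> 2/3 * N"
    using sum_bounded_below[of "offsets d R" "2/3" "\<lambda>U. prob (acc (tree_fun d b d U))"] yes(2)
    by (simp add: N_def mult.commute)
  then have "m * (\<Sum>U\<in>offsets d R. prob (acc (tree_fun d b d U))) \<ge> m * (2/3 * N)"
    by (intro mult_left_mono) (auto simp: m_def)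
  moreover have "(\<Sum>(i, U)\<in>J. prob (acc (tree_fun d b i U))) \<le> real (card J) * (1/3)"
    using no(2) by (intro sum_bounded_above) (auto simp: J_def)
  moreover have "real (card J) = m * real (card (offsets d R'))"
    by (simp add: J_def m_def card_cartesian_product)
  moreover have ratio: "4 * real (card (offsets d R')) \<le> 5 * N" "N > 0"
    using card_offsets_ratio[of d K R "\<lambda>k. b ^ (d - k)" R'] d b
    by (auto simp: K_def[symmetric] R_def R'_def N_def)
  moreover have "m * (4 * real (card (offsets d R'))) \<le> m * (5 * N)"
    using ratio(1) by (intro mult_left_mono) (auto simp: m_def)
  \<comment> \<open>With \<open>m = d - 1\<close>, the averages give
    \<open>2/3 * m * N \<le> q * N + 1/3 * m * (5/4 * N)\<close>, and 2/3 - 5/12 = 1/4.\<close>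
  ultimately have "m * N \<le> 4 * (real q * N)" by argo
  then show ?thesis using ratio(2) by (simp add: m_def)
qed

theorem theorem6:
  shows "\<exists>\<epsilon>0 > 0. \<exists>c > 0. \<exists>d0. \<forall>d \<ge> d0. \<forall>q M Q D.
           unateness_tester d \<epsilon>0 q M Q D \<longrightarrow> real q \<ge> c * real d"
\<comment> \<open>The constant 1/8 comes from \<open>d - 1 \<ge> d / 2\<close> for
  \<open>d \<ge> 2\<close>.\<close>
proof (rule exI[of _ "1/4"], intro conjI, simp, rule exI[of _ "1/8"], intro conjI, simp,
    intro exI[of _ 2] allI impI)
  fix d q :: nat and M Q D
  assume d: "2 \<le> d" and "unateness_tester d (1/4) q M Q D"
  then have "real (d - 1) \<le> 4 * real q" by (intro unateness_tester_queries)
  with d show "1/8 * real d \<le> real q" by simp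
qed

end
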